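(* For any set $X\subseteq \mathbb{R}$ the following conditions are equivalent: (i) For every $\varepsilon >0$ there exists a closed set $C\subseteq \mathbb{R}$ with $\lambda (\mathbb{R}\setminus C)<\varepsilon$ containing no similar copy of $X$. (ii) $\mu_X\equiv0$ on $\mathbb{R} \times (\mathbb{R}\setminus\{0\})$, i.e. $\mu_X(A)=0$ for all $A\subseteq \mathbb{R} \times (\mathbb{R}\setminus\{0\})$. (iii) There exists a set $U\subseteq \mathbb{R} \times (\mathbb{R}\setminus\{0\})$ with nonempty interior such that $\mu_X(U)=0$.
   Context: $\lambda$ denotes outer Lebesgue measure on $\mathbb{R}$. A similar copy of $X\subseteq\mathbb{R}$ is a set $a+bX=\{a+bx: x\in X\}$ with $a\in\mathbb{R}$, $b\in\mathbb{R}\setminus\{0\}$. For $X\subseteq\mathbb{R}$, $z\in\mathbb{R}$ and $G\subseteq\mathbb{R}$ put $L_X(z)=\{(z-bx, b): b\in\mathbb{R},\ x\in X\}\subseteq\mathbb{R}^2$ and $L_X(G)=\bigcup_{z\in G}L_X(z)$. For $A\subseteq\mathbb{R}\times(\mathbb{R}\setminus\{0\})$ put $$\mu_X(A)=\inf\{\lambda(G):G\subseteq \mathbb{R}\text{ and }L_X(G)\supseteq A\},$$ with the convention $\inf\emptyset=+\infty$. *)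

theory Defs
  imports "HOL-Analysis.Analysis"
begin

abbreviation outer_lebesgue :: "real set \<Rightarrow> ennreal" where
  "outer_lebesgue \<equiv> outer_measure_of lebesgue"

definition similar_copy :: "real set \<Rightarrow> real set \<Rightarrow> bool" where
  "similar_copy X Y \<longleftrightarrow> (\<exists>a b. b \<noteq> 0 \<and> Y = (\<lambda>x. a + b * x) ` X)"

definition L_pt :: "real set \<Rightarrow> real \<Rightarrow> (real \<times> real) set" where
  "L_pt X z = {(z - b * x, b) | b x. x \<in> X}"

definition L_set :: "real set \<Rightarrow> real set \<Rightarrow> (real \<times> real) set" where
  "L_set X G = (\<Union>z\<in>G. L_pt X z)"

text \<open>If no \<open>G\<close> is admissible, the value is \<open>Inf {} = \<infinity>\<close> in \<^typ>\<open>ennreal\<close>.\<close>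

definition mu :: "real set \<Rightarrow> (real \<times> real) set \<Rightarrow> ennreal" where
  "mu X A = Inf {outer_lebesgue G | G. A \<subseteq> L_set X G}"

end

theory Submission
  imports Defs
begin

text \<open>A pair \<open>(a, b)\<close> lies in \<open>L_set X G\<close> iff the copy \<open>a + bX\<close> meets \<open>G\<close>, so the complement of an
  open \<open>G\<close> avoids all similar copies of \<open>X\<close> iff \<open>L_set X G\<close> contains the whole region \<open>b \<noteq> 0\<close>. The
  affine group acts simply transitively on that region by \<open>(a, b) \<mapsto> (t + s a, s b)\<close>, and this action
  corresponds to \<open>G \<mapsto> t + s G\<close>, hence preserves \<open>mu\<close>-null sets. By the Lindelof property, countably
  many images of one open null set cover the region.\<close>

lemma mem_L_set_iff: "(a, b) \<in> L_set X G \<longleftrightarrow> (\<exists>x\<in>X. a + b * x \<in> G)"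
proof -
  have "a = z - b * x \<longleftrightarrow> z = a + b * x" for x z by auto
  then show ?thesis unfolding L_set_def L_pt_def by auto
qed

lemma L_set_UN: "L_set X (\<Union>i\<in>I. G i) = (\<Union>i\<in>I. L_set X (G i))"
  unfolding L_set_def by blast

lemma L_set_mono: "G \<subseteq> H \<Longrightarrow> L_set X G \<subseteq> L_set X H"
  unfolding L_set_def by blast

text \<open>Since t + s(a + bx) = (t + sa) + (sb)x, the same \<open>x\<close> witnesses membership
  before and after the affine map.\<close>

lemma L_set_affine:
  "(\<lambda>p. (t, 0) + s *\<^sub>R p) ` L_set X G \<subseteq> L_set X ((\<lambda>z. t + s * z) ` G)"
proof (rule image_subsetI)
  fix p assume "p \<in> L_set X G"
  moreover obtain a b where p: "p = (a, b)" by fastforce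
  ultimately obtain x where "x \<in> X" "a + b * x \<in> G"
    by (auto simp: mem_L_set_iff)
  then have "(t + s * a) + s * b * x \<in> (\<lambda>z. t + s * z) ` G"
    by (intro image_eqI[of _ _ "a + b * x"]) (simp_all add: algebra_simps)
  then have "(t + s * a, s * b) \<in> L_set X ((\<lambda>z. t + s * z) ` G)"
    using \<open>x \<in> X\<close> unfolding mem_L_set_iff by blast
  then show "(t, 0) + s *\<^sub>R p \<in> L_set X ((\<lambda>z. t + s * z) ` G)" by (simp add: p)
qed

text \<open>Outer regularity in two stages: a measurable superset \<open>B\<close> of finite measure
  \<open>r\<close> < \<open>\<epsilon>\<close>, then an open superset of \<open>B\<close> that
  spends only the remaining \<open>\<epsilon> - r\<close>.\<close>

lemma outer_lebesgue_less_open: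
  assumes "outer_lebesgue G < ennreal \<epsilon>"
  obtains V where "open V" "G \<subseteq> V" "emeasure lebesgue V < ennreal \<epsilon>"
proof -
  from assms obtain B where B: "B \<in> sets lebesgue" "G \<subseteq> B" "emeasure lebesgue B < ennreal \<epsilon>"
    unfolding outer_measure_of_def INF_less_iff by auto
  then obtain r where r: "emeasure lebesgue B = ennreal r" "0 \<le> r" "r < \<epsilon>"
    by (cases "emeasure lebesgue B") (auto simp: ennreal_less_iff)
  then obtain V where V: "open V" "B \<subseteq> V" "V - B \<in> lmeasurable"
      "emeasure lebesgue (V - B) < ennreal (\<epsilon> - r)"
    using sets_lebesgue_outer_open[OF B(1), of "\<epsilon> - r"] by auto
  have "emeasure lebesgue V \<le> emeasure lebesgue B + emeasure lebesgue (V - B)"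
    using emeasure_subadditive[of B lebesgue "V - B"] B(1) V(2,3)
    by (simp add: fmeasurableD Un_absorb1)
  \<comment> \<open>Strictness survives the addition because \<open>ennreal r\<close> is
    finite.\<close>
  also have "\<dots> < ennreal r + ennreal (\<epsilon> - r)"
    using V(4) r(1) by (simp add: ennreal_add_left_cancel_less)
  also have "\<dots> = ennreal \<epsilon>"
    using r by (simp flip: ennreal_plus)
  finally show ?thesis using that V(1,2) B(2) by blast
qed

lemma outer_lebesgue_open: "open V \<Longrightarrow> outer_lebesgue V = emeasure lebesgue V" for V :: "real set"
  by (simp add: outer_measure_of_eq borel_open lborelD)

text \<open>\<open>L_set X\<close> is monotone, so a cheap \<open>G\<close> may be enlarged to a
  cheap open one. Open sets are the complements of the closed sets in condition (i), which makes
  this form directly comparable with it.\<close>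

lemma mu_eq_0_iff:
  "mu X A = 0 \<longleftrightarrow>
    (\<forall>\<epsilon>>0. \<exists>G. open G \<and> emeasure lebesgue G < ennreal \<epsilon> \<and> A \<subseteq> L_set X G)"
proof safe
  fix \<epsilon> :: real assume "mu X A = 0" "\<epsilon> > 0"
  then have "Inf {outer_lebesgue G | G. A \<subseteq> L_set X G} < ennreal \<epsilon>"
    unfolding mu_def by simp
  then obtain G where "outer_lebesgue G < ennreal \<epsilon>" "A \<subseteq> L_set X G"
    unfolding Inf_less_iff by blast
  then show "\<exists>G. open G \<and> emeasure lebesgue G < ennreal \<epsilon> \<and> A \<subseteq> L_set X G"
    by (meson L_set_mono order_trans outer_lebesgue_less_open)
next
  assume *: "\<forall>\<epsilon>>0. \<exists>G. open G \<and> emeasure lebesgue G < ennreal \<epsilon> \<and> A \<subseteq> L_set X G"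
  have "mu X A \<le> 0"
  proof (rule ennreal_le_epsilon)
    fix \<epsilon> :: real assume "\<epsilon> > 0"
    with * obtain G where G: "open G" "emeasure lebesgue G < ennreal \<epsilon>" "A \<subseteq> L_set X G" by blast
    then have "mu X A \<le> outer_lebesgue G"
      unfolding mu_def by (intro Inf_lower) blast
    then show "mu X A \<le> 0 + ennreal \<epsilon>"
      using G by (metis add_0 less_imp_le order_trans outer_lebesgue_open)
  qed
  then show "mu X A = 0" by simp
qed

lemma mu_eq_0_subset: "mu X B = 0 \<Longrightarrow> A \<subseteq> B \<Longrightarrow> mu X A = 0"
  unfolding mu_eq_0_iff by (meson order_trans)

text \<open>If \<open>G\<close> serves for \<open>A\<close>, its image under z -> t + sz serves for
  the image of \<open>A\<close> and has measure multiplied by |s|; hence the choice of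
  \<open>\<epsilon> / \<bar>s\<bar>\<close> for \<open>G\<close>.\<close>

lemma mu_eq_0_affine:
  assumes "mu X A = 0" "s \<noteq> 0"
  shows "mu X ((\<lambda>p. (t, 0) + s *\<^sub>R p) ` A) = 0"
  unfolding mu_eq_0_iff
proof safe
  fix \<epsilon> :: real assume "\<epsilon> > 0"
  then have "\<epsilon> / \<bar>s\<bar> > 0" using assms(2) by simp
  then obtain G where G: "open G" "emeasure lebesgue G < ennreal (\<epsilon> / \<bar>s\<bar>)" "A \<subseteq> L_set X G"
    using assms(1) unfolding mu_eq_0_iff by blast
  let ?H = "(\<lambda>z. t + s * z) ` G"
  \<comment> \<open>Openness is obtained by scaling first and translating second.\<close>
  have "?H = (+) t ` ((*\<^sub>R) s ` G)" by (simp add: image_image)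
  then have "open ?H"
    using open_translation[OF open_scaling[OF assms(2) G(1)]] by simp
  moreover have "emeasure lebesgue ?H < ennreal \<epsilon>"
  proof -
    have "emeasure lebesgue ?H = ennreal \<bar>s\<bar> * emeasure lebesgue G"
      using emeasure_lebesgue_affine[of s t G] by (simp add: add.commute)
    also have "\<dots> < ennreal \<bar>s\<bar> * ennreal (\<epsilon> / \<bar>s\<bar>)"
      using G(2) assms(2) by (simp add: ennreal_mult_strict_left_mono)
    also have "\<dots> = ennreal \<epsilon>"
      using assms(2) \<open>\<epsilon> > 0\<close> by (simp flip: ennreal_mult)
    finally show ?thesis .
  qed
  moreover have "(\<lambda>p. (t, 0) + s *\<^sub>R p) ` A \<subseteq> L_set X ?H"
    using image_mono[OF G(3)] L_set_affine by (rule order_trans)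
  ultimately show "\<exists>G. open G \<and> emeasure lebesgue G < ennreal \<epsilon> \<and>
      (\<lambda>p. (t, 0) + s *\<^sub>R p) ` A \<subseteq> L_set X G" by blast
qed

lemma mu_eq_0_UN:
  fixes A :: "nat \<Rightarrow> (real \<times> real) set"
  assumes "\<And>n. mu X (A n) = 0"
  shows "mu X (\<Union>n. A n) = 0"
  unfolding mu_eq_0_iff
proof safe
  fix \<epsilon> :: real assume "\<epsilon> > 0"
  \<comment> \<open>The budgets sum to \<open>\<epsilon> / 2\<close>, so the non-strict bound on the
    series still leaves a strict bound by \<open>\<epsilon>\<close>.\<close>
  define \<delta> where "\<delta> n = \<epsilon> / 2 * (1/2) ^ Suc n" for n
  have "\<exists>G. open G \<and> emeasure lebesgue G < ennreal (\<delta> n) \<and> A n \<subseteq> L_set X G" for n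
    using assms[of n] \<open>\<epsilon> > 0\<close> unfolding mu_eq_0_iff by (simp add: \<delta>_def)
  then obtain G where G: "\<And>n. open (G n)" "\<And>n. emeasure lebesgue (G n) < ennreal (\<delta> n)"
    "\<And>n. A n \<subseteq> L_set X (G n)" by metis
  have "\<delta> sums (\<epsilon> / 2)"
    using sums_mult[OF power_half_series, of "\<epsilon> / 2"] by (simp add: \<delta>_def[abs_def])
  then have sum: "(\<Sum>n. ennreal (\<delta> n)) = ennreal (\<epsilon> / 2)"
    using \<open>\<epsilon> > 0\<close> by (intro suminf_ennreal_eq) (simp add: \<delta>_def)
  have "emeasure lebesgue (\<Union>n. G n) \<le> (\<Sum>n. emeasure lebesgue (G n))"
    using G(1) by (intro emeasure_subadditive_countably) (auto simp: borel_open lborelD)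
  also have "\<dots> \<le> (\<Sum>n. ennreal (\<delta> n))"
    using G(2) by (intro suminf_le) (auto intro: less_imp_le)
  also have "\<dots> < ennreal \<epsilon>"
    using sum \<open>\<epsilon> > 0\<close> by (simp add: ennreal_lessI)
  finally have "emeasure lebesgue (\<Union>n. G n) < ennreal \<epsilon>" .
  moreover have "(\<Union>n. A n) \<subseteq> L_set X (\<Union>n. G n)"
    unfolding L_set_UN using G(3) by (rule UN_mono[OF order_refl])
  moreover have "open (\<Union>n. G n)" using G(1) by blast
  ultimately show "\<exists>G. open G \<and> emeasure lebesgue G < ennreal \<epsilon> \<and> (\<Union>n. A n) \<subseteq> L_set X G"
    by (intro exI conjI)
qed

lemma mu_eq_0_everywhere:
  assumes U: "U \<subseteq> UNIV \<times> (UNIV - {0})" "interior U \<noteq> {}" "mu X U = 0"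
  shows "mu X (UNIV \<times> (UNIV - {0})) = 0"
proof -
  define V where "V = interior U"
  have V: "open V" "V \<subseteq> U" by (auto simp: V_def interior_subset)
  obtain a0 b0 where ab0: "(a0, b0) \<in> V" using U(2) unfolding V_def by fastforce
  with V U have b0: "b0 \<noteq> 0" by auto
  \<comment> \<open>The orbit of the open null set \<open>V\<close> under the affine group: a family
    of open null sets.\<close>
  define F where "F = {(\<lambda>p. (t, 0) + s *\<^sub>R p) ` V | s t :: real. s \<noteq> 0}"
  have open_F: "open S" if "S \<in> F" for S
  proof -
    from that obtain s t :: real where "s \<noteq> 0" "S = (\<lambda>p. (t, 0) + s *\<^sub>R p) ` V"
      unfolding F_def by blast
    then show ?thesis
      using open_translation[OF open_scaling[OF _ V(1)], of s "(t, 0)"] by (simp add: image_image)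
  qed
  have null_F: "mu X S = 0" if "S \<in> F" for S
    using that mu_eq_0_affine[OF mu_eq_0_subset[OF U(3) V(2)]] unfolding F_def by blast
  have cover: "UNIV \<times> (UNIV - {0}) \<subseteq> \<Union>F"
  proof
    fix p :: "real \<times> real" assume "p \<in> UNIV \<times> (UNIV - {0})"
    then obtain a b where p: "p = (a, b)" and "b \<noteq> 0" by auto
    \<comment> \<open>The only group element taking \<open>(a0, b0)\<close> to
      \<open>(a, b)\<close>: the second coordinate forces s = b / b0, then the first forces t = a -
      s a0.\<close>
    let ?f = "\<lambda>p. (a - b / b0 * a0, 0) + (b / b0) *\<^sub>R p"
    have "?f (a0, b0) = (a, b)" using b0 by simp
    then have "(a, b) \<in> ?f ` V" using ab0 by (metis image_eqI)
    moreover have "b / b0 \<noteq> 0" using b0 \<open>b \<noteq> 0\<close> by simp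
    then have "?f ` V \<in> F" unfolding F_def by blast
    ultimately show "p \<in> \<Union>F" unfolding p by blast
  qed
  obtain F' where F': "F' \<subseteq> F" "countable F'" "\<Union>F' = \<Union>F"
    using Lindelof[of F] open_F by blast
  \<comment> \<open>Nonemptiness ensures that \<open>from_nat_into F'\<close> enumerates exactly
    \<open>F'\<close>.\<close>
  have "F' \<noteq> {}" using cover F'(3) by fastforce
  then have "mu X (\<Union>n. from_nat_into F' n) = 0"
    using F'(1) null_F from_nat_into[of F'] by (intro mu_eq_0_UN) blast
  then have "mu X (\<Union>F) = 0"
    using F' \<open>F' \<noteq> {}\<close> by (simp add: range_from_nat_into)
  then show ?thesis using cover by (rule mu_eq_0_subset)
qed

text \<open>The copy with parameters \<open>(a, b)\<close> avoids \<open>G\<close> exactly when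
  \<open>(a, b)\<close> lies outside \<open>L_set X G\<close>. For empty \<open>X\<close> both sides
  fail: the empty copy lies in \<open>- G\<close>, and \<open>L_set X G\<close> is empty.\<close>

lemma no_similar_copy_iff:
  "\<not> (\<exists>Y. similar_copy X Y \<and> Y \<subseteq> - G) \<longleftrightarrow> UNIV \<times> (UNIV - {0}) \<subseteq> L_set X G"
proof -
  have "UNIV \<times> (UNIV - {0}) \<subseteq> L_set X G \<longleftrightarrow> (\<forall>a b. b \<noteq> 0 \<longrightarrow> (\<exists>x\<in>X. a + b * x \<in> G))"
    by (auto simp: subset_iff mem_L_set_iff)
  moreover have "(\<exists>Y. similar_copy X Y \<and> Y \<subseteq> - G) \<longleftrightarrow> (\<exists>a b. b \<noteq> 0 \<and> (\<forall>x\<in>X. a + b * x \<notin> G))"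
    unfolding similar_copy_def by blast
  ultimately show ?thesis by blast
qed

theorem theorem2:
  fixes X :: "real set"
  shows
    "((\<forall>\<epsilon>::real. \<epsilon> > 0 \<longrightarrow>
        (\<exists>C. closed C \<and> outer_lebesgue (UNIV - C) < ennreal \<epsilon> \<and>
             \<not> (\<exists>Y. similar_copy X Y \<and> Y \<subseteq> C)))
      \<longleftrightarrow> (\<forall>A \<subseteq> UNIV \<times> (UNIV - {0}). mu X A = 0))
     \<and>
     ((\<forall>A \<subseteq> UNIV \<times> (UNIV - {0}). mu X A = 0)
      \<longleftrightarrow> (\<exists>U \<subseteq> UNIV \<times> (UNIV - {0}). interior U \<noteq> {} \<and> mu X U = 0))"
proof -
  let ?R = "UNIV \<times> (UNIV - {0}) :: (real \<times> real) set"
  have closed_iff_open: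
    "(\<exists>C. closed C \<and> outer_lebesgue (UNIV - C) < ennreal \<epsilon> \<and>
       \<not> (\<exists>Y. similar_copy X Y \<and> Y \<subseteq> C)) \<longleftrightarrow>
     (\<exists>G. open G \<and> emeasure lebesgue G < ennreal \<epsilon> \<and> ?R \<subseteq> L_set X G)" for \<epsilon>
  proof -
    \<comment> \<open>Complementation is a bijection on sets, so \<open>C\<close> can be replaced by
      \<open>- G\<close>.\<close>
    have "(\<exists>C. P C) \<longleftrightarrow> (\<exists>G. P (- G))" for P :: "real set \<Rightarrow> bool"
      by (metis double_complement)
    then show ?thesis
      unfolding no_similar_copy_iff[symmetric]
      by (metis (no_types, lifting) Compl_eq_Diff_UNIV double_complement closed_Compl open_Compl
          outer_lebesgue_open)
  qed
  have all_iff: "(\<forall>A\<subseteq>?R. mu X A = 0) \<longleftrightarrow> mu X ?R = 0"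
    using mu_eq_0_subset by blast
  \<comment> \<open>The region is open and nonempty, so it can itself serve as \<open>U\<close> in
    condition (iii).\<close>
  have "interior ?R = ?R"
    by (intro interior_open open_Times) auto
  then have "interior ?R \<noteq> {}" by (auto intro: exI[of _ 1])
  then have "mu X ?R = 0 \<longleftrightarrow> (\<exists>U\<subseteq>?R. interior U \<noteq> {} \<and> mu X U = 0)"
    using mu_eq_0_everywhere by blast
  \<comment> \<open>Conditions (i) and (ii) both become \<open>mu X ?R = 0\<close>, the first
    through the open-cover criterion and the second by monotonicity.\<close>
  then show ?thesis
    unfolding all_iff closed_iff_open mu_eq_0_iff[of X ?R, symmetric] by blast
qed

end
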